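(* Every finitely generated torsion-free (Gromov) hyperbolic group $G$ admits a limit aperiodic coloring by $9$ colors, i.e. there exist a set $F$ with $9$ elements and a limit aperiodic coloring $\phi:G\to F$.
   Context: A coloring of a set $X$ by a set of colors $F$ is a map $\phi:X\to F$. The set $F^X$ of all colorings carries the product topology, with $F$ discrete. A discrete group $G$ acts on $F^G$ from the left by $(g\phi)(x)=\phi(g^{-1}x)$. A coloring $\phi:G\to F$ is aperiodic if $g\phi\neq\phi$ for all $g\in G\setminus\{e\}$. It is limit aperiodic if every $\psi$ in the closure $\overline{G\phi}\subset F^G$ of the orbit $G\phi$ is aperiodic (equivalently, $G$ acts freely on $\overline{G\phi}$). *)

theory Defs
  imports "HOL-Analysis.Analysis" "HOL-Algebra.Generated_Groups"
begin

section \<open>Hyperbolic groups\<close>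

definition finitely_generated_group :: "('a, 'b) monoid_scheme \<Rightarrow> bool" where
  "finitely_generated_group G \<longleftrightarrow>
     group G \<and> (\<exists>S. finite S \<and> S \<subseteq> carrier G \<and> generate G S = carrier G)"

definition torsion_free_group :: "('a, 'b) monoid_scheme \<Rightarrow> bool" where
  "torsion_free_group G \<longleftrightarrow>
     group G \<and> (\<forall>g\<in>carrier G. \<forall>n::nat. n > 0 \<longrightarrow> g [^]\<^bsub>G\<^esub> n = \<one>\<^bsub>G\<^esub> \<longrightarrow> g = \<one>\<^bsub>G\<^esub>)"

text \<open>If \<open>S\<close> does not generate \<open>G\<close>, the \<open>LEAST\<close> below ranges over an empty set for the elements
  outside the generated subgroup. The definition is only used for generating sets.\<close>

definition word_length :: "('a, 'b) monoid_scheme \<Rightarrow> 'a set \<Rightarrow> 'a \<Rightarrow> nat" where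
  "word_length G S g =
     (LEAST n. \<exists>ws. length ws = n \<and> set ws \<subseteq> S \<union> (\<lambda>s. inv\<^bsub>G\<^esub> s) ` S
                    \<and> foldr (\<otimes>\<^bsub>G\<^esub>) ws \<one>\<^bsub>G\<^esub> = g)"

definition word_dist :: "('a, 'b) monoid_scheme \<Rightarrow> 'a set \<Rightarrow> 'a \<Rightarrow> 'a \<Rightarrow> real" where
  "word_dist G S x y = real (word_length G S (inv\<^bsub>G\<^esub> x \<otimes>\<^bsub>G\<^esub> y))"

definition gromov_product :: "('a \<Rightarrow> 'a \<Rightarrow> real) \<Rightarrow> 'a \<Rightarrow> 'a \<Rightarrow> 'a \<Rightarrow> real" where
  "gromov_product d w x y = (d x w + d y w - d x y) / 2"

text \<open>Gromov's four-point condition, required for every base point.\<close>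

definition gromov_hyperbolic :: "'a set \<Rightarrow> ('a \<Rightarrow> 'a \<Rightarrow> real) \<Rightarrow> bool" where
  "gromov_hyperbolic M d \<longleftrightarrow>
     (\<exists>\<delta>\<ge>0. \<forall>w\<in>M. \<forall>x\<in>M. \<forall>y\<in>M. \<forall>z\<in>M.
        gromov_product d w x z \<ge> min (gromov_product d w x y) (gromov_product d w y z) - \<delta>)"

text \<open>Hyperbolicity of the word metric does not depend on the finite generating set, so
  \<open>for some\<close> and \<open>for every\<close> finite generating set describe the same finitely generated groups.\<close>

definition hyperbolic_group :: "('a, 'b) monoid_scheme \<Rightarrow> bool" where
  "hyperbolic_group G \<longleftrightarrow>
     group G \<and> (\<exists>S. finite S \<and> S \<subseteq> carrier G \<and> generate G S = carrier G
                    \<and> gromov_hyperbolic (carrier G) (word_dist G S))"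

section \<open>Limit aperiodic colorings\<close>

text \<open>A coloring of \<open>G\<close> by \<open>F\<close> is an element of \<open>carrier G \<rightarrow>\<^sub>E F\<close>: it is \<open>undefined\<close> outside
  the carrier, so that equality of colorings is equality of HOL functions. This set is the
  underlying set of the following topology.\<close>

definition coloring_space :: "('a, 'b) monoid_scheme \<Rightarrow> 'c set \<Rightarrow> ('a \<Rightarrow> 'c) topology" where
  "coloring_space G F = product_topology (\<lambda>_. discrete_topology F) (carrier G)"

definition shift :: "('a, 'b) monoid_scheme \<Rightarrow> 'a \<Rightarrow> ('a \<Rightarrow> 'c) \<Rightarrow> ('a \<Rightarrow> 'c)" where
  "shift G g \<phi> = (\<lambda>x\<in>carrier G. \<phi> (inv\<^bsub>G\<^esub> g \<otimes>\<^bsub>G\<^esub> x))"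

definition shift_orbit :: "('a, 'b) monoid_scheme \<Rightarrow> ('a \<Rightarrow> 'c) \<Rightarrow> ('a \<Rightarrow> 'c) set" where
  "shift_orbit G \<phi> = (\<lambda>g. shift G g \<phi>) ` carrier G"

definition aperiodic_coloring :: "('a, 'b) monoid_scheme \<Rightarrow> ('a \<Rightarrow> 'c) \<Rightarrow> bool" where
  "aperiodic_coloring G \<phi> \<longleftrightarrow> (\<forall>g\<in>carrier G - {\<one>\<^bsub>G\<^esub>}. shift G g \<phi> \<noteq> \<phi>)"

definition limit_aperiodic_coloring ::
  "('a, 'b) monoid_scheme \<Rightarrow> 'c set \<Rightarrow> ('a \<Rightarrow> 'c) \<Rightarrow> bool" where
  "limit_aperiodic_coloring G F \<phi> \<longleftrightarrow>
     \<phi> \<in> carrier G \<rightarrow>\<^sub>E F \<and>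
     (\<forall>\<psi> \<in> (coloring_space G F) closure_of (shift_orbit G \<phi>). aperiodic_coloring G \<psi>)"

section \<open>Consistency checks\<close>

lemma topspace_coloring_space: "topspace (coloring_space G F) = carrier G \<rightarrow>\<^sub>E F"
  by (simp add: coloring_space_def)

lemma (in group) shift_closed:
  assumes "g \<in> carrier G" "\<phi> \<in> carrier G \<rightarrow>\<^sub>E F"
  shows "shift G g \<phi> \<in> carrier G \<rightarrow>\<^sub>E F"
  using assms by (auto simp: shift_def)

lemma (in group) shift_one:
  assumes "\<phi> \<in> carrier G \<rightarrow>\<^sub>E F"
  shows "shift G \<one> \<phi> = \<phi>"
  using assms by (auto simp: shift_def fun_eq_iff PiE_def extensional_def)

lemma (in group) shift_mult:
  assumes "g \<in> carrier G" "h \<in> carrier G"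
  shows "shift G (g \<otimes> h) \<phi> = shift G g (shift G h \<phi>)"
  using assms by (auto simp: shift_def fun_eq_iff inv_mult_group m_assoc)

lemma (in group) foldr_closed:
  assumes "set ws \<subseteq> carrier G"
  shows "foldr (\<otimes>) ws \<one> \<in> carrier G"
  using assms by (induction ws) auto

lemma (in group) foldr_append_mult:
  assumes "set us \<subseteq> carrier G" "set vs \<subseteq> carrier G"
  shows "foldr (\<otimes>) (us @ vs) \<one> = foldr (\<otimes>) us \<one> \<otimes> foldr (\<otimes>) vs \<one>"
  using assms by (induction us) (auto simp: m_assoc foldr_closed)

lemma (in group) foldr_inv:
  assumes "set ws \<subseteq> carrier G"
  shows "foldr (\<otimes>) (rev (map (\<lambda>x. inv x) ws)) \<one> = inv (foldr (\<otimes>) ws \<one>)"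
  using assms
proof (induction ws)
  case (Cons a ws)
  have "foldr (\<otimes>) (rev (map (\<lambda>x. inv x) ws) @ [inv a]) \<one> 
        = foldr (\<otimes>) (rev (map (\<lambda>x. inv x) ws)) \<one> \<otimes> foldr (\<otimes>) [inv a] \<one>"
    using Cons.prems by (intro foldr_append_mult) auto
  with Cons show ?case by (simp add: inv_mult_group foldr_closed)
qed simp

context group
begin

context
  fixes S assumes S: "S \<subseteq> carrier G" "generate G S = carrier G"
begin

abbreviation (input) letters where "letters \<equiv> S \<union> (\<lambda>s. inv s) ` S"

lemma letters_carrier: "letters \<subseteq> carrier G"
  using S by auto

lemma word_exists:
  assumes "g \<in> carrier G"
  shows "\<exists>ws. set ws \<subseteq> letters \<and> foldr (\<otimes>) ws \<one> = g"
proof -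
  have "g \<in> generate G S" using assms S by simp
  then show ?thesis
  proof induction
    case one
    show ?case by (rule exI[of _ "[]"]) simp
  next
    case (incl h)
    then show ?case using S by (intro exI[of _ "[h]"]) auto
  next
    case (inv h)
    then show ?case using S by (intro exI[of _ "[inv h]"]) auto
  next
    case (eng g h)
    then obtain us vs where "set us \<subseteq> letters" "foldr (\<otimes>) us \<one> = g"
      "set vs \<subseteq> letters" "foldr (\<otimes>) vs \<one> = h" by blast
    then show ?case using foldr_append_mult[of us vs] letters_carrier
      by (intro exI[of _ "us @ vs"]) auto
  qed
qed

lemma word_length_le:
  assumes "set ws \<subseteq> letters"
  shows "word_length G S (foldr (\<otimes>) ws \<one>) \<le> length ws"
  unfolding word_length_def using assms by (intro Least_le) auto

lemma word_length_witness:
  assumes "g \<in> carrier G"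
  obtains ws where "set ws \<subseteq> letters" "foldr (\<otimes>) ws \<one> = g" "length ws = word_length G S g"
proof -
  have "\<exists>n ws. length ws = n \<and> set ws \<subseteq> letters \<and> foldr (\<otimes>) ws \<one> = g"
    using word_exists[OF assms] by auto
  from LeastI_ex[OF this] show ?thesis
    using that unfolding word_length_def by auto
qed

lemma word_length_eq_0:
  assumes "g \<in> carrier G"
  shows "word_length G S g = 0 \<longleftrightarrow> g = \<one>"
proof
  assume "word_length G S g = 0"
  with word_length_witness[OF assms] show "g = \<one>"
    by (metis foldr_Nil id_apply length_0_conv)
next
  assume "g = \<one>"
  then show "word_length G S g = 0"
    using word_length_le[of "[]"] by simp
qed

lemma word_length_mult:
  assumes "g \<in> carrier G" "h \<in> carrier G"
  shows "word_length G S (g \<otimes> h) \<le> word_length G S g + word_length G S h"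
proof -
  obtain us where us: "set us \<subseteq> letters" "foldr (\<otimes>) us \<one> = g" "length us = word_length G S g"
    using word_length_witness[OF assms(1)] .
  obtain vs where vs: "set vs \<subseteq> letters" "foldr (\<otimes>) vs \<one> = h" "length vs = word_length G S h"
    using word_length_witness[OF assms(2)] .
  have "foldr (\<otimes>) (us @ vs) \<one> = g \<otimes> h"
    using foldr_append_mult[of us vs] us vs letters_carrier by auto
  with word_length_le[of "us @ vs"] us vs show ?thesis by auto
qed

lemma word_length_inv_le:
  assumes "g \<in> carrier G"
  shows "word_length G S (inv g) \<le> word_length G S g"
proof -
  obtain ws where ws: "set ws \<subseteq> letters" "foldr (\<otimes>) ws \<one> = g" "length ws = word_length G S g"
    using word_length_witness[OF assms] .
  have "inv x \<in> letters" if "x \<in> letters" for x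
    using that S by auto
  then have "set (rev (map (\<lambda>x. inv x) ws)) \<subseteq> letters"
    using ws(1) unfolding set_rev set_map by blast
  from word_length_le[OF this] show ?thesis
    using foldr_inv[of ws] ws letters_carrier by auto
qed

lemma word_length_inv:
  assumes "g \<in> carrier G"
  shows "word_length G S (inv g) = word_length G S g"
  using word_length_inv_le[of g] word_length_inv_le[of "inv g"] assms by simp

text \<open>\<open>Metric_space\<close> asks for symmetry also off the carrier, where nothing is known about
  \<open>word_dist\<close>. Hence the restriction.\<close>

lemma Metric_space_word_dist:
  "Metric_space (carrier G)
     (\<lambda>x y. if x \<in> carrier G \<and> y \<in> carrier G then word_dist G S x y else 0)"
proof
  fix x y
  show "0 \<le> (if x \<in> carrier G \<and> y \<in> carrier G then word_dist G S x y else 0)"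
    by (simp add: word_dist_def)
  show "(if x \<in> carrier G \<and> y \<in> carrier G then word_dist G S x y else 0)
      = (if y \<in> carrier G \<and> x \<in> carrier G then word_dist G S y x else 0)"
    using word_length_inv[of "inv x \<otimes> y"] by (auto simp: word_dist_def inv_mult_group)
next
  fix x y assume xy: "x \<in> carrier G" "y \<in> carrier G"
  have "inv x \<otimes> y = \<one> \<longleftrightarrow> x = y"
    using xy by (metis inv_closed inv_equality inv_inv l_inv)
  then show "(if x \<in> carrier G \<and> y \<in> carrier G then word_dist G S x y else 0) = 0 \<longleftrightarrow> x = y"
    using xy by (simp add: word_dist_def word_length_eq_0)
next
  fix x y z assume xyz: "x \<in> carrier G" "y \<in> carrier G" "z \<in> carrier G"
  have "inv x \<otimes> z = (inv x \<otimes> y) \<otimes> (inv y \<otimes> z)"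
    using xyz by (simp add: m_assoc flip: m_assoc[of y "inv y" z])
  then have "word_length G S (inv x \<otimes> z) 
      \<le> word_length G S (inv x \<otimes> y) + word_length G S (inv y \<otimes> z)"
    using word_length_mult[of "inv x \<otimes> y" "inv y \<otimes> z"] xyz by simp
  then show "(if x \<in> carrier G \<and> z \<in> carrier G then word_dist G S x z else 0)
      \<le> (if x \<in> carrier G \<and> y \<in> carrier G then word_dist G S x y else 0)
       + (if y \<in> carrier G \<and> z \<in> carrier G then word_dist G S y z else 0)"
    using xyz by (simp add: word_dist_def)
qed

end

end

end

theory Submission
  imports Defs "HOL-Algebra.Multiplicative_Group"
begin

text \<open>
  A torsion-free group is trivial or infinite, and a finitely generated group is countable. The
  theorem is therefore, apart from the trivial group, a case of the one for infinite countable
  groups (\<open>infinite_countable_group_limit_aperiodic\<close>).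

  The idea is to make aperiodicity a local condition with a uniform bound. Attach to every
  \<open>s \<noteq> \<one>\<close> a finite test set \<open>T s\<close> disjoint from \<open>s T s\<close>, and ask of a coloring that on every translate
  \<open>g T s\<close> its pattern differs from the one on \<open>g s T s\<close>. Each of these conditions looks at finitely
  many points only, so the colorings satisfying all of them form a closed set. It is invariant
  under the shifts, hence contains the orbit closure of each of its members. If \<open>\<psi>\<close> in this set were
  fixed by the shift by \<open>h \<noteq> \<one>\<close>, its patterns on \<open>T s\<close> and \<open>s T s\<close> would agree for \<open>s = h\<inverse>\<close>. So
  every member is limit aperiodic (\<open>limit_aperiodicI\<close>).

  It remains to find one member. The test sets can be chosen of pairwise different sizes, all at
  least 2: only a few are small, and a coincidence of patterns on large sets is rare. A counting
  argument, an elementary substitute for the Lovasz local lemma, shows that adding a point to a finite set multiplies the number of its admissible colorings by at least 8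
  (\<open>card_good_insert\<close>): of the nine ways to color the new point at most one, on average, completes
  a forbidden coincidence. Hence all finite sets have admissible colorings, and by compactness the
  whole group has one (\<open>colorings_without_repetitions_exist\<close>).
\<close>

section \<open>Counting colorings without repetitions\<close>

text \<open>
  A repetition \<open>i\<close> consists of a pattern \<open>P i\<close> and a disjoint copy of it under \<open>f i\<close>; a coloring
  repeats if it takes equal values at \<open>x\<close> and \<open>f i x\<close> for all \<open>x \<in> P i\<close>. The number \<open>\<beta>\<close> is the
  growth rate to be established, and the summand \<open>\<beta> / \<beta> ^ card (P i)\<close> bounds the average number of
  colors at \<open>v\<close> that are lost to the repetition \<open>i\<close>: in the half of it that contains \<open>v\<close>,
  all other points were already colored, and each of these \<open>card (P i) - 1\<close> points had at least \<open>\<beta>\<close>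
  choices on average, of which the repetition leaves one.
  The condition is imposed for finite \<open>J\<close> so that sums over an infinite \<open>I\<close> never occur.
\<close>

locale sparse_repetitions =
  fixes V :: "'a set" and I :: "'i set" and P :: "'i \<Rightarrow> 'a set" and f :: "'i \<Rightarrow> 'a \<Rightarrow> 'a"
    and F :: "'c set" and \<beta> :: real
  assumes finite_colors: "finite F"
    and beta_pos: "\<beta> > 0"
    and finite_P: "i \<in> I \<Longrightarrow> finite (P i)"
    and P_nonempty: "i \<in> I \<Longrightarrow> P i \<noteq> {}"
    and P_subset: "i \<in> I \<Longrightarrow> P i \<subseteq> V"
    and image_subset: "i \<in> I \<Longrightarrow> f i ` P i \<subseteq> V"
    and f_inj: "i \<in> I \<Longrightarrow> inj_on (f i) (P i)"
    and disjoint: "i \<in> I \<Longrightarrow> P i \<inter> f i ` P i = {}"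
    and weight: "\<lbrakk>finite J; J \<subseteq> I; v \<in> V\<rbrakk> \<Longrightarrow>
      \<beta> + (\<Sum>i\<in>{i\<in>J. v \<in> P i \<union> f i ` P i}. \<beta> / \<beta> ^ card (P i)) \<le> real (card F)"
begin

text \<open>
  Only repetitions that lie inside \<open>X\<close> as a whole are forbidden: this makes restrictions of good
  colorings good.
\<close>

definition good :: "'i set \<Rightarrow> 'a set \<Rightarrow> ('a \<Rightarrow> 'c) set" where
  "good J X = {\<phi> \<in> X \<rightarrow>\<^sub>E F. \<forall>i\<in>J. P i \<union> f i ` P i \<subseteq> X \<longrightarrow> (\<exists>x\<in>P i. \<phi> x \<noteq> \<phi> (f i x))}"

lemma finite_good: "finite X \<Longrightarrow> finite (good J X)"
  unfolding good_def by (rule finite_subset[OF _ finite_PiE[of X "\<lambda>_. F"]]) (auto simp: finite_colors)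

lemma restrict_good:
  assumes "\<phi> \<in> good J X" "Y \<subseteq> X"
  shows "restrict \<phi> Y \<in> good J Y"
  unfolding good_def
proof (intro CollectI conjI ballI impI)
  show "restrict \<phi> Y \<in> Y \<rightarrow>\<^sub>E F" using assms by (auto simp: good_def)
next
  fix i assume i: "i \<in> J" "P i \<union> f i ` P i \<subseteq> Y"
  then obtain x where "x \<in> P i" "\<phi> x \<noteq> \<phi> (f i x)"
    using assms by (fastforce simp: good_def)
  then show "\<exists>x\<in>P i. restrict \<phi> Y x \<noteq> restrict \<phi> Y (f i x)"
    using i(2) by (intro bexI[of _ x]) auto
qed

lemma card_extensions:
  assumes "finite X" "v \<notin> X"
  shows "card {\<phi> \<in> insert v X \<rightarrow>\<^sub>E F. restrict \<phi> X \<in> good J X} = card F * card (good J X)"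
proof -
  let ?E = "{\<phi> \<in> insert v X \<rightarrow>\<^sub>E F. restrict \<phi> X \<in> good J X}"
  have "bij_betw (\<lambda>\<phi>. (\<phi> v, restrict \<phi> X)) ?E (F \<times> good J X)"
  proof (rule bij_betw_byWitness[where f' = "\<lambda>(c, \<phi>). \<phi>(v := c)"])
    show "\<forall>\<phi>\<in>?E. (case (\<phi> v, restrict \<phi> X) of (c, \<phi>) \<Rightarrow> \<phi>(v := c)) = \<phi>"
      by (auto simp: fun_eq_iff restrict_def PiE_def extensional_def)
    have *: "restrict (\<phi>(v := c)) X = \<phi>" if "\<phi> \<in> good J X" for \<phi> c
      using that assms(2) by (auto simp: good_def fun_eq_iff PiE_def extensional_def)
    then show "\<forall>p\<in>F \<times> good J X. (\<lambda>\<phi>. (\<phi> v, restrict \<phi> X)) (case p of (c, \<phi>) \<Rightarrow> \<phi>(v := c)) = p"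
      by auto
    show "(\<lambda>\<phi>. (\<phi> v, restrict \<phi> X)) ` ?E \<subseteq> F \<times> good J X"
      by auto
    have "\<phi>(v := c) \<in> insert v X \<rightarrow>\<^sub>E F" if "\<phi> \<in> good J X" "c \<in> F" for \<phi> c
      using that by (auto simp: good_def PiE_def extensional_def)
    with * show "(\<lambda>(c, \<phi>). \<phi>(v := c)) ` (F \<times> good J X) \<subseteq> ?E"
      by (intro image_subsetI) (simp only: mem_Times_iff mem_Collect_eq split_beta)
  qed
  from bij_betw_same_card[OF this] show ?thesis by (simp add: card_cartesian_product)
qed

text \<open>
  A coloring that repeats at \<open>i\<close> can be recovered from its values off one half of the repetition,
  since the other half carries the same colors. Erasing the half that contains \<open>v\<close> leaves a good
  coloring of the smaller set \<open>Y\<close>, so these colorings are no more numerous than those of \<open>Y\<close>.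
\<close>

lemma card_repeating_extensions:
  assumes "finite X" "v \<notin> X" "i \<in> I" "P i \<union> f i ` P i \<subseteq> insert v X" "v \<in> P i \<union> f i ` P i"
  obtains Y where "Y \<subseteq> X" "Suc (card (X - Y)) = card (P i)"
    "card {\<phi> \<in> insert v X \<rightarrow>\<^sub>E F. restrict \<phi> X \<in> good J X \<and> (\<forall>x\<in>P i. \<phi> x = \<phi> (f i x))}
      \<le> card (good J Y)"
proof -
  let ?B = "{\<phi> \<in> insert v X \<rightarrow>\<^sub>E F. restrict \<phi> X \<in> good J X \<and> (\<forall>x\<in>P i. \<phi> x = \<phi> (f i x))}"
  define D where "D = (if v \<in> P i then P i else f i ` P i)"
  have D: "v \<in> D" "D \<subseteq> insert v X" "finite D" "card D = card (P i)"
    using assms(3-5) finite_P f_inj by (auto simp: D_def card_image)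
  \<comment> \<open>The partner map sends each half of the repetition to the other half.\<close>
  have partner: "\<exists>y. y \<in> X - D \<and> (\<forall>\<phi>\<in>?B. \<phi> x = \<phi> y)" if x: "x \<in> D" for x
  proof (cases "v \<in> P i")
    case True
    with x disjoint[OF assms(3)] assms(4) show ?thesis
      by (intro exI[of _ "f i x"]) (auto simp: D_def)
  next
    case False
    with x obtain y where "y \<in> P i" "x = f i y" by (auto simp: D_def)
    with False disjoint[OF assms(3)] assms(4) show ?thesis
      by (intro exI[of _ y]) (auto simp: D_def)
  qed
  have "inj_on (\<lambda>\<phi>. restrict \<phi> (X - D)) ?B"
  proof (rule inj_onI)
    fix \<phi> \<psi> assume B: "\<phi> \<in> ?B" "\<psi> \<in> ?B" and eq: "restrict \<phi> (X - D) = restrict \<psi> (X - D)"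
    have off: "\<phi> x = \<psi> x" if "x \<in> X - D" for x
      using fun_cong[OF eq, of x] that by auto
    have "\<phi> x = \<psi> x" for x
    proof -
      consider "x \<in> X - D" | "x \<in> D" | "x \<notin> insert v X" using D(1,2) by auto
      then show ?thesis
      proof cases
        case 2
        with partner obtain y where "y \<in> X - D" "\<phi> x = \<phi> y" "\<psi> x = \<psi> y" using B by blast
        with off show ?thesis by simp
      qed (use off B in \<open>auto simp: PiE_def extensional_def\<close>)
    qed
    then show "\<phi> = \<psi>" by auto
  qed
  moreover have "(\<lambda>\<phi>. restrict \<phi> (X - D)) ` ?B \<subseteq> good J (X - D)"
  proof (intro image_subsetI)
    fix \<phi> assume "\<phi> \<in> ?B"
    then have "restrict (restrict \<phi> X) (X - D) \<in> good J (X - D)"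
      by (intro restrict_good[of "restrict \<phi> X" J X]) blast+
    moreover have "restrict (restrict \<phi> X) (X - D) = restrict \<phi> (X - D)" by auto
    ultimately show "restrict \<phi> (X - D) \<in> good J (X - D)" by simp
  qed
  ultimately have "card ?B \<le> card (good J (X - D))"
    using assms(1) by (rule card_inj_on_le[OF _ _ finite_good[OF finite_Diff]])
  moreover have "X - (X - D) = D - {v}" using D(2) assms(2) by auto
  then have "Suc (card (X - (X - D))) = card (P i)"
    using card_Suc_Diff1[OF D(3,1)] D(4) by simp
  ultimately show ?thesis by (intro that[of "X - D"]) auto
qed

lemma card_good_iterate:
  assumes "finite X" "Y \<subseteq> X"
    and step: "\<And>Z v. \<lbrakk>Z \<subset> X; v \<in> X - Z\<rbrakk> \<Longrightarrow> \<beta> * card (good J Z) \<le> card (good J (insert v Z))"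
  shows "\<beta> ^ card (X - Y) * card (good J Y) \<le> card (good J X)"
proof -
  have "\<beta> ^ card W * card (good J Y) \<le> card (good J (Y \<union> W))" if "finite W" "W \<subseteq> X - Y" for W
    using that
  proof (induction W rule: finite_induct)
    case (insert w W)
    have "\<beta> ^ card (insert w W) * card (good J Y) = \<beta> * (\<beta> ^ card W * card (good J Y))"
      using insert by simp
    also have "\<dots> \<le> \<beta> * card (good J (Y \<union> W))"
      using insert beta_pos by (intro mult_left_mono) auto
    also have "\<dots> \<le> card (good J (insert w (Y \<union> W)))"
      using insert assms(2) by (intro step) auto
    finally show ?case by simp
  qed simp
  from this[of "X - Y"] show ?thesis using assms(1,2) by (simp add: Un_absorb1)
qed

text \<open>
  An extension of a good coloring of \<open>X\<close> by a color of \<open>v\<close> fails to be good only by a repetition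
  through \<open>v\<close>. By the previous lemmas and the induction hypothesis, applied along a chain from \<open>Y\<close>
  up to \<open>X\<close>, the repetition \<open>i\<close> spoils at most \<open>\<beta> / \<beta> ^ card (P i)\<close> extensions per good coloring of
  \<open>X\<close>. The weight condition says that \<open>\<beta>\<close> extensions remain.
\<close>

lemma card_good_insert:
  assumes J: "finite J" "J \<subseteq> I"
  shows "\<lbrakk>finite X; X \<subseteq> V; v \<in> V; v \<notin> X\<rbrakk> \<Longrightarrow> \<beta> * card (good J X) \<le> card (good J (insert v X))"
proof (induction "card X" arbitrary: X v rule: less_induct)
  case less
  let ?N = "card (good J X)"
  let ?E = "{\<phi> \<in> insert v X \<rightarrow>\<^sub>E F. restrict \<phi> X \<in> good J X}"
  define Jv where "Jv = {i\<in>J. v \<in> P i \<union> f i ` P i}"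
  define K where "K = {i\<in>Jv. P i \<union> f i ` P i \<subseteq> insert v X}"
  define B where
    "B i = {\<phi> \<in> insert v X \<rightarrow>\<^sub>E F. restrict \<phi> X \<in> good J X \<and> (\<forall>x\<in>P i. \<phi> x = \<phi> (f i x))}" for i
  have fin: "finite Jv" "finite K" using J by (auto simp: Jv_def K_def)
  have card_B: "card (B i) \<le> \<beta> / \<beta> ^ card (P i) * ?N" if i: "i \<in> K" for i
  proof -
    have "i \<in> I" "P i \<union> f i ` P i \<subseteq> insert v X" "v \<in> P i \<union> f i ` P i"
      using i J by (auto simp: K_def Jv_def)
    from card_repeating_extensions[OF less.prems(1,4) this, of J]
    obtain Y where Y: "Y \<subseteq> X" "Suc (card (X - Y)) = card (P i)" "card (B i) \<le> card (good J Y)"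
      unfolding B_def by blast
    have "\<beta> ^ card (X - Y) * card (good J Y) \<le> ?N"
    proof (rule card_good_iterate[OF less.prems(1) Y(1)])
      fix Z w assume Z: "Z \<subset> X" "w \<in> X - Z"
      then show "\<beta> * card (good J Z) \<le> card (good J (insert w Z))"
        using less.prems by (intro less.hyps psubset_card_mono) (auto intro: finite_subset)
    qed
    moreover have "\<beta> ^ card (X - Y) * card (B i) \<le> \<beta> ^ card (X - Y) * card (good J Y)"
      using Y(3) beta_pos by (intro mult_left_mono) auto
    ultimately have "\<beta> ^ card (X - Y) * card (B i) \<le> ?N" by linarith
    then show ?thesis using beta_pos unfolding Y(2)[symmetric] by (simp add: field_simps)
  qed
  have "?E \<subseteq> good J (insert v X) \<union> (\<Union>i\<in>K. B i)"
  proof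
    fix \<phi> assume \<phi>: "\<phi> \<in> ?E"
    show "\<phi> \<in> good J (insert v X) \<union> (\<Union>i\<in>K. B i)"
    proof (rule ccontr)
      assume neg: "\<phi> \<notin> good J (insert v X) \<union> (\<Union>i\<in>K. B i)"
      then obtain i where i: "i \<in> J" "P i \<union> f i ` P i \<subseteq> insert v X" "\<forall>x\<in>P i. \<phi> x = \<phi> (f i x)"
        using \<phi> by (auto simp: good_def[of J "insert v X"])
      show False
      proof (cases "v \<in> P i \<union> f i ` P i")
        case True
        with i(1,2) have "i \<in> K" by (simp add: K_def Jv_def)
        moreover have "\<phi> \<in> B i" using \<phi> i(3) by (simp add: B_def)
        ultimately show False using neg by blast
      next
        case False
        with i(2) have *: "P i \<union> f i ` P i \<subseteq> X" by blast
        then obtain x where "x \<in> P i" "restrict \<phi> X x \<noteq> restrict \<phi> X (f i x)"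
          using \<phi> i(1) by (auto simp: good_def)
        with * i(3) show False by (auto split: if_splits)
      qed
    qed
  qed
  moreover have fin': "finite (insert v X \<rightarrow>\<^sub>E F)" using less.prems finite_colors by (intro finite_PiE) auto
  then have finB: "finite (B i)" for i by (rule finite_subset[rotated]) (auto simp: B_def)
  ultimately have "card ?E \<le> card (good J (insert v X) \<union> (\<Union>i\<in>K. B i))"
    using fin less.prems(1) by (intro card_mono) (auto intro: finite_good)
  also have "\<dots> \<le> card (good J (insert v X)) + (\<Sum>i\<in>K. card (B i))"
    using card_Un_le card_UN_le[OF fin(2), of B] by (meson add_left_mono order_trans)
  finally have "card F * ?N \<le> card (good J (insert v X)) + (\<Sum>i\<in>K. card (B i))"
    unfolding card_extensions[OF less.prems(1,4)] .
  then have "real (card F * ?N) \<le> real (card (good J (insert v X)) + (\<Sum>i\<in>K. card (B i)))"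
    by (rule of_nat_mono)
  also have "\<dots> = card (good J (insert v X)) + (\<Sum>i\<in>K. real (card (B i)))"
    by simp
  also have "(\<Sum>i\<in>K. real (card (B i))) \<le> (\<Sum>i\<in>K. \<beta> / \<beta> ^ card (P i) * ?N)"
    by (intro sum_mono card_B)
  also have "\<dots> \<le> (\<Sum>i\<in>Jv. \<beta> / \<beta> ^ card (P i) * ?N)"
    using fin beta_pos by (intro sum_mono2) (auto simp: K_def)
  also have "\<dots> = (\<Sum>i\<in>Jv. \<beta> / \<beta> ^ card (P i)) * ?N"
    by (simp add: sum_distrib_right)
  also have "\<dots> \<le> (card F - \<beta>) * ?N"
    using weight[OF J less.prems(3)] unfolding Jv_def by (intro mult_right_mono) auto
  finally show ?case by (simp add: algebra_simps)
qed

lemma good_nonempty: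
  assumes "finite J" "J \<subseteq> I" "finite X" "X \<subseteq> V"
  shows "good J X \<noteq> {}"
proof -
  have "\<beta> ^ card (X - {}) * card (good J {}) \<le> card (good J X)"
    using assms by (intro card_good_iterate card_good_insert) (auto intro: finite_subset)
  moreover have "good J {} = {\<lambda>_. undefined}"
    using assms P_nonempty by (auto simp: good_def)
  ultimately have "\<beta> ^ card (X - {}) \<le> card (good J X)" by simp
  moreover have "\<beta> ^ card (X - {}) > 0" using beta_pos by simp
  ultimately show ?thesis by (metis card.empty not_le of_nat_0)
qed

end

section \<open>Passing to infinite sets\<close>

lemma closedin_two_values_differ:
  assumes "x \<in> V" "y \<in> V"
  shows "closedin (product_topology (\<lambda>_. discrete_topology F) V) {\<phi> \<in> V \<rightarrow>\<^sub>E F. \<phi> x \<noteq> \<phi> y}"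
proof -
  let ?X = "product_topology (\<lambda>_. discrete_topology F) V"
  have "continuous_map ?X (prod_topology (discrete_topology F) (discrete_topology F)) (\<lambda>\<phi>. (\<phi> x, \<phi> y))"
    using assms by (intro continuous_map_pairedI continuous_map_product_projection)
  then have "closedin ?X {\<phi> \<in> topspace ?X. (\<phi> x, \<phi> y) \<in> {p \<in> F \<times> F. fst p \<noteq> snd p}}"
    by (rule closedin_continuous_map_preimage)
      (auto simp flip: prod_topology_discrete_topology)
  moreover have "{\<phi> \<in> topspace ?X. (\<phi> x, \<phi> y) \<in> {p \<in> F \<times> F. fst p \<noteq> snd p}}
      = {\<phi> \<in> V \<rightarrow>\<^sub>E F. \<phi> x \<noteq> \<phi> y}"
    using assms by auto
  ultimately show ?thesis by simp
qed

lemma closedin_no_repetition: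
  assumes "finite P" "P \<subseteq> V" "f ` P \<subseteq> V"
  shows "closedin (product_topology (\<lambda>_. discrete_topology F) V)
    {\<phi> \<in> V \<rightarrow>\<^sub>E F. \<exists>x\<in>P. \<phi> x \<noteq> \<phi> (f x)}"
proof -
  have "{\<phi> \<in> V \<rightarrow>\<^sub>E F. \<exists>x\<in>P. \<phi> x \<noteq> \<phi> (f x)} = (\<Union>x\<in>P. {\<phi> \<in> V \<rightarrow>\<^sub>E F. \<phi> x \<noteq> \<phi> (f x)})"
    by auto
  then show ?thesis
    using assms by (auto intro!: closedin_Union closedin_two_values_differ)
qed

context sparse_repetitions
begin

text \<open>
  Good colorings of finite sets extend arbitrarily to \<open>V\<close>, so finitely many repetitions can always
  be avoided together; by Tychonoff's theorem this passes to all of \<open>I\<close>.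
\<close>

lemma colorings_without_repetitions_exist:
  "\<exists>\<phi> \<in> V \<rightarrow>\<^sub>E F. \<forall>i\<in>I. \<exists>x\<in>P i. \<phi> x \<noteq> \<phi> (f i x)"
proof (cases "V \<rightarrow>\<^sub>E F = {}")
  case True
  then obtain v where v: "v \<in> V" "F = {}" by (auto simp: PiE_eq_empty_iff)
  with weight[of "{}" v] beta_pos show ?thesis by simp
next
  case False
  let ?X = "product_topology (\<lambda>_. discrete_topology F) V"
  define C where "C i = {\<phi> \<in> V \<rightarrow>\<^sub>E F. \<exists>x\<in>P i. \<phi> x \<noteq> \<phi> (f i x)}" for i
  have nonempty: "(V \<rightarrow>\<^sub>E F) \<inter> (\<Inter>i\<in>J. C i) \<noteq> {}" if J: "finite J" "J \<subseteq> I" for J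
  proof -
    define X where "X = (\<Union>i\<in>J. P i \<union> f i ` P i)"
    have X: "finite X" "X \<subseteq> V"
      using J finite_P P_subset image_subset unfolding X_def by blast+
    then obtain \<phi> where \<phi>: "\<phi> \<in> good J X" using good_nonempty[OF J] by blast
    obtain \<psi> where \<psi>: "\<psi> \<in> V \<rightarrow>\<^sub>E F" using False by blast
    define \<theta> where "\<theta> x = (if x \<in> X then \<phi> x else \<psi> x)" for x
    have "\<theta> \<in> V \<rightarrow>\<^sub>E F"
      using \<phi> \<psi> X by (auto simp: \<theta>_def good_def PiE_def extensional_def)
    moreover have "\<exists>x\<in>P i. \<theta> x \<noteq> \<theta> (f i x)" if "i \<in> J" for i
    proof -
      have supp: "P i \<union> f i ` P i \<subseteq> X" using that by (auto simp: X_def)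
      with \<phi> that have "\<exists>x\<in>P i. \<phi> x \<noteq> \<phi> (f i x)" by (simp add: good_def)
      then obtain x where "x \<in> P i" "\<phi> x \<noteq> \<phi> (f i x)" by blast
      with supp show ?thesis by (intro bexI[of _ x]) (auto simp: \<theta>_def)
    qed
    ultimately show ?thesis by (auto simp: C_def)
  qed
  have "compact_space ?X"
    using finite_colors by (simp add: compact_space_product_topology compact_space_discrete_topology)
  moreover have "\<forall>A\<in>insert (V \<rightarrow>\<^sub>E F) (C ` I). closedin ?X A"
    using closedin_topspace[of ?X]
    by (auto simp: C_def intro!: closedin_no_repetition finite_P dest: P_subset image_subset)
  moreover have "\<Inter>\<F> \<noteq> {}" if "finite \<F>" "\<F> \<subseteq> insert (V \<rightarrow>\<^sub>E F) (C ` I)" for \<F>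
  proof -
    have \<F>: "finite (\<F> - {V \<rightarrow>\<^sub>E F})" "\<F> - {V \<rightarrow>\<^sub>E F} \<subseteq> C ` I"
      using that by auto
    obtain J where J: "J \<subseteq> I" "finite J" "\<F> - {V \<rightarrow>\<^sub>E F} = C ` J"
      using finite_subset_image[OF \<F>] by auto
    have "(V \<rightarrow>\<^sub>E F) \<inter> \<Inter>(\<F> - {V \<rightarrow>\<^sub>E F}) \<subseteq> \<Inter>\<F>" by blast
    then have "(V \<rightarrow>\<^sub>E F) \<inter> (\<Inter>i\<in>J. C i) \<subseteq> \<Inter>\<F>" unfolding J(3) .
    with nonempty[OF J(2,1)] show ?thesis by (metis subset_empty)
  qed
  \<comment> \<open>The whole space is a member of the family because the intersection over no repetitions
    would otherwise be \<open>UNIV\<close>, which also contains functions that are no colorings.\<close>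
  ultimately have "\<Inter>(insert (V \<rightarrow>\<^sub>E F) (C ` I)) \<noteq> {}"
    unfolding compact_space_fip by blast
  then show ?thesis by (auto simp: C_def)
qed

end

section \<open>Limit aperiodic colorings of infinite countable groups\<close>

text \<open>
  Points are added one by one. A new point \<open>u\<close> must avoid only \<open>T\<close>, \<open>s T\<close> and \<open>s\<inverse> T\<close>, and an infinite
  group has such a point.
\<close>

lemma (in group) displaced_finite_set:
  assumes "infinite (carrier G)" "s \<in> carrier G" "s \<noteq> \<one>"
  shows "\<exists>T. finite T \<and> T \<subseteq> carrier G \<and> card T = n \<and> T \<inter> (\<lambda>t. s \<otimes> t) ` T = {}"
proof (induction n)
  case 0
  show ?case by (intro exI[of _ "{}"]) auto
next
  case (Suc n)
  then obtain T where T: "finite T" "T \<subseteq> carrier G" "card T = n" "T \<inter> (\<lambda>t. s \<otimes> t) ` T = {}"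
    by blast
  have "finite (T \<union> (\<lambda>t. s \<otimes> t) ` T \<union> (\<lambda>t. inv s \<otimes> t) ` T)" using T by auto
  from Diff_infinite_finite[OF this assms(1)]
  have "carrier G - (T \<union> (\<lambda>t. s \<otimes> t) ` T \<union> (\<lambda>t. inv s \<otimes> t) ` T) \<noteq> {}"
    by (rule infinite_imp_nonempty)
  then obtain u where u: "u \<in> carrier G" "u \<notin> T \<union> (\<lambda>t. s \<otimes> t) ` T \<union> (\<lambda>t. inv s \<otimes> t) ` T"
    by blast
  have "s \<otimes> u \<noteq> u" using assms u(1) by (simp add: r_cancel_one)
  moreover have "s \<otimes> u \<notin> T"
  proof
    assume "s \<otimes> u \<in> T"
    then have "inv s \<otimes> (s \<otimes> u) \<in> (\<lambda>t. inv s \<otimes> t) ` T" by blast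
    with u assms(2) show False by (simp flip: m_assoc)
  qed
  ultimately show ?case
    using T u by (intro exI[of _ "insert u T"]) auto
qed

text \<open>
  The summand for \<open>s\<close> is the total weight of the repetitions of kind \<open>s\<close> through one point: the point
  can sit at any of the \<open>2 (e s + 2)\<close> positions. This is the estimate that makes the growth rate 8
  possible with 9 colors, already for test sets whose sizes start at 2.
\<close>

lemma sum_weights_le_one:
  fixes e :: "'a \<Rightarrow> nat"
  assumes "finite A" "inj_on e A"
  shows "(\<Sum>s\<in>A. 2 * real (e s + 2) * (8 / 8 ^ (e s + 2))) \<le> 1"
proof -
  \<comment> \<open>The subtracted term bounds the tail of the series, which makes the claim inductive.\<close>
  have partial: "(\<Sum>n<N. 2 * real (n + 2) * (8 / 8 ^ (n + 2))) \<le> 1 - real (N + 2) / 2 / 8 ^ N" for N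
  proof (induction N)
    case (Suc N)
    have "1 - real (N + 2) / 2 / 8 ^ N + 2 * real (N + 2) * (8 / 8 ^ (N + 2))
        \<le> 1 - real (Suc N + 2) / 2 / 8 ^ Suc N"
      by (simp add: divide_simps)
    with Suc show ?case by simp
  qed simp
  obtain N where N: "e ` A \<subseteq> {..<N}"
    using assms(1) by (meson finite_imageI finite_nat_iff_bounded)
  have "(\<Sum>s\<in>A. 2 * real (e s + 2) * (8 / 8 ^ (e s + 2)))
      = (\<Sum>n\<in>e ` A. 2 * real (n + 2) * (8 / 8 ^ (n + 2)))"
    by (simp add: sum.reindex[OF assms(2)])
  also have "\<dots> \<le> (\<Sum>n<N. 2 * real (n + 2) * (8 / 8 ^ (n + 2)))"
    using N by (intro sum_mono2) auto
  also have "\<dots> \<le> 1"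
    by (rule order_trans[OF partial]) simp
  finally show ?thesis .
qed

text \<open>
  The repetitions are indexed by pairs \<open>(g, s)\<close>. The pattern \<open>g T s\<close> is moved to \<open>g s T s\<close> by left
  multiplication with the conjugate \<open>g s g\<inverse>\<close>. An injection \<open>e\<close> of the group into the natural numbers
  prescribes the sizes of the test sets.
\<close>

lemma (in group) no_translation_repetitions:
  fixes F :: "'c set"
  assumes inf: "infinite (carrier G)" and cnt: "countable (carrier G)"
    and F: "finite F" "card F \<ge> 9"
  obtains T \<phi> where "\<And>s. s \<in> carrier G - {\<one>} \<Longrightarrow> finite (T s) \<and> T s \<subseteq> carrier G"
    "\<phi> \<in> carrier G \<rightarrow>\<^sub>E F"
    "\<And>g s. \<lbrakk>g \<in> carrier G; s \<in> carrier G - {\<one>}\<rbrakk> \<Longrightarrow> \<exists>t\<in>T s. \<phi> (g \<otimes> t) \<noteq> \<phi> (g \<otimes> (s \<otimes> t))"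
proof -
  obtain e :: "'a \<Rightarrow> nat" where e: "inj_on e (carrier G)" using cnt by (auto simp: countable_def)
  define T where "T s = (SOME T. finite T \<and> T \<subseteq> carrier G \<and> card T = e s + 2
    \<and> T \<inter> (\<lambda>t. s \<otimes> t) ` T = {})" for s
  have T: "finite (T s)" "T s \<subseteq> carrier G" "card (T s) = e s + 2" "T s \<inter> (\<lambda>t. s \<otimes> t) ` T s = {}"
    if "s \<in> carrier G - {\<one>}" for s
    using someI_ex[OF displaced_finite_set[OF inf, of s "e s + 2"]] that unfolding T_def by blast+
  define I where "I = carrier G \<times> (carrier G - {\<one>})"
  define P where "P = (\<lambda>(g, s). (\<lambda>t. g \<otimes> t) ` T s)"
  define f where "f = (\<lambda>(g, s) x. g \<otimes> (s \<otimes> (inv g \<otimes> x)))"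
  have f: "f (g, s) (g \<otimes> t) = g \<otimes> (s \<otimes> t)" if "g \<in> carrier G" "s \<in> carrier G" "t \<in> carrier G" for g s t
    using that by (simp add: f_def flip: m_assoc[of "inv g" g t])
  have image: "f (g, s) ` P (g, s) = (\<lambda>t. g \<otimes> (s \<otimes> t)) ` T s" if "(g, s) \<in> I" for g s
    using that T(2)[of s] unfolding P_def I_def
    by (auto simp: image_image subset_iff f intro!: image_cong)
  have card_P: "card (P (g, s)) = e s + 2" if "(g, s) \<in> I" for g s
  proof -
    have "inj_on (\<lambda>t. g \<otimes> t) (T s)" using that T(2)[of s] by (auto simp: I_def inj_on_def subset_iff)
    then show ?thesis using that T(3)[of s] by (simp add: P_def I_def card_image)
  qed
  interpret sparse_repetitions "carrier G" I P f F 8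
  proof
    show "finite F" "(0::real) < 8" using F by auto
  next
    fix i assume i: "i \<in> I"
    obtain g s where gs: "i = (g, s)" by (cases i)
    with i have g: "g \<in> carrier G" and s: "s \<in> carrier G - {\<one>}" by (auto simp: I_def)
    have Tc: "t \<in> carrier G" if "t \<in> T s" for t using T(2)[OF s] that by auto
    show "finite (P i)" "P i \<subseteq> carrier G" using T[OF s] g gs by (auto simp: P_def)
    show "P i \<noteq> {}" using card_P[of g s] i gs by auto
    show "f i ` P i \<subseteq> carrier G" using image[of g s] T(2)[OF s] g s gs i by auto
    show "inj_on (f i) (P i)" using g s by (auto simp: inj_on_def gs P_def f Tc)
    show "P i \<inter> f i ` P i = {}"
      using image[of g s] T(4)[OF s] g s i by (auto simp: gs P_def Tc)
  next
    fix J v assume J: "finite J" "J \<subseteq> I" and v: "v \<in> carrier G"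
    let ?Jv = "{i\<in>J. v \<in> P i \<union> f i ` P i}"
    define A where "A = snd ` J"
    have A: "finite A" "A \<subseteq> carrier G - {\<one>}" using J by (auto simp: A_def I_def)
    have "(\<Sum>i\<in>?Jv. 8 / 8 ^ card (P i)) = (\<Sum>s\<in>A. \<Sum>i\<in>{i\<in>?Jv. snd i = s}. 8 / 8 ^ card (P i) :: real)"
      using J A by (intro sum.group[symmetric]) (auto simp: A_def)
    also have "\<dots> \<le> (\<Sum>s\<in>A. 2 * real (e s + 2) * (8 / 8 ^ (e s + 2)))"
    proof (rule sum_mono)
      fix s assume "s \<in> A"
      with A have s: "s \<in> carrier G - {\<one>}" by auto
      let ?K = "{i\<in>?Jv. snd i = s}"
      \<comment> \<open>The base point of a repetition is determined by \<open>s\<close> and the position of \<open>v\<close> in it.\<close>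
      let ?U = "(\<lambda>t. (v \<otimes> inv t, s)) ` T s \<union> (\<lambda>t. (v \<otimes> inv (s \<otimes> t), s)) ` T s"
      have "?K \<subseteq> ?U"
      proof
        fix i assume i: "i \<in> ?K"
        then obtain g where gs: "i = (g, s)" "g \<in> carrier G" "(g, s) \<in> I" "v \<in> P (g, s) \<union> f (g, s) ` P (g, s)"
          using J by (cases i) (auto simp: I_def)
        have solve: "g = (g \<otimes> t) \<otimes> inv t" if "t \<in> carrier G" for t
          using that gs by (simp add: m_assoc)
        from gs(4) consider t where "t \<in> T s" "v = g \<otimes> t" | t where "t \<in> T s" "v = g \<otimes> (s \<otimes> t)"
          unfolding image[OF gs(3)] by (auto simp: P_def)
        then show "i \<in> ?U"
        proof cases
          case 1
          with solve[of t] T(2)[OF s] have "i = (v \<otimes> inv t, s)" by (auto simp: gs(1))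
          with 1 show ?thesis by blast
        next
          case 2
          with solve[of "s \<otimes> t"] T(2)[OF s] s have "i = (v \<otimes> inv (s \<otimes> t), s)"
            by (auto simp: gs(1))
          with 2 show ?thesis by blast
        qed
      qed
      then have "card ?K \<le> card ?U" using T(1)[OF s] by (intro card_mono) auto
      also have "\<dots> \<le> card (T s) + card (T s)"
        using card_Un_le card_image_le[OF T(1)[OF s]] by (meson add_mono order_trans)
      finally have "real (card ?K) \<le> 2 * real (e s + 2)" using T(3)[OF s] by simp
      moreover have "(\<Sum>i\<in>?K. 8 / 8 ^ card (P i)) = (\<Sum>i\<in>?K. 8 / 8 ^ (e s + 2) :: real)"
        using J(2) card_P by (intro sum.cong) auto
      ultimately show "(\<Sum>i\<in>?K. 8 / 8 ^ card (P i)) \<le> 2 * real (e s + 2) * (8 / 8 ^ (e s + 2))"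
        by (simp only: sum_constant) (intro mult_right_mono, auto)
    qed
    also have "\<dots> \<le> 1" using A e by (intro sum_weights_le_one) (auto intro: inj_on_subset)
    finally show "8 + (\<Sum>i\<in>?Jv. 8 / 8 ^ card (P i)) \<le> real (card F)" using F by simp
  qed
  obtain \<phi> where \<phi>: "\<phi> \<in> carrier G \<rightarrow>\<^sub>E F" "\<forall>i\<in>I. \<exists>x\<in>P i. \<phi> x \<noteq> \<phi> (f i x)"
    using colorings_without_repetitions_exist by blast
  show ?thesis
  proof (rule that[of T \<phi>])
    fix g s assume gs: "g \<in> carrier G" "s \<in> carrier G - {\<one>}"
    then have "(g, s) \<in> I" by (simp add: I_def)
    with \<phi>(2) obtain t where "t \<in> T s" "\<phi> (g \<otimes> t) \<noteq> \<phi> (f (g, s) (g \<otimes> t))"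
      by (fastforce simp: P_def)
    then show "\<exists>t\<in>T s. \<phi> (g \<otimes> t) \<noteq> \<phi> (g \<otimes> (s \<otimes> t))"
      using f[of g s t] gs T(2)[of s] by (intro bexI[of _ t]) auto
  qed (use T \<phi> in auto)
qed

text \<open>
  The test set \<open>T s\<close> must not depend on \<open>g\<close>: this uniformity is what survives in limits of shifts,
  where an aperiodic coloring may otherwise lose its aperiodicity.
\<close>

lemma (in group) limit_aperiodicI:
  assumes T: "\<And>s. s \<in> carrier G - {\<one>} \<Longrightarrow> finite (T s) \<and> T s \<subseteq> carrier G"
    and \<phi>: "\<phi> \<in> carrier G \<rightarrow>\<^sub>E F"
    and free: "\<And>g s. \<lbrakk>g \<in> carrier G; s \<in> carrier G - {\<one>}\<rbrakk>
      \<Longrightarrow> \<exists>t\<in>T s. \<phi> (g \<otimes> t) \<noteq> \<phi> (g \<otimes> (s \<otimes> t))"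
  shows "limit_aperiodic_coloring G F \<phi>"
  unfolding limit_aperiodic_coloring_def aperiodic_coloring_def
proof (intro conjI ballI notI)
  show "\<phi> \<in> carrier G \<rightarrow>\<^sub>E F" by fact
next
  fix \<psi> h
  assume \<psi>: "\<psi> \<in> coloring_space G F closure_of shift_orbit G \<phi>"
    and h: "h \<in> carrier G - {\<one>}" and fixed: "shift G h \<psi> = \<psi>"
  define s where "s = inv h"
  have s: "s \<in> carrier G - {\<one>}" using h by (auto simp: s_def inv_eq_1_iff)
  let ?C = "{\<psi> \<in> carrier G \<rightarrow>\<^sub>E F. \<exists>t\<in>T s. \<psi> t \<noteq> \<psi> (s \<otimes> t)}"
  have "closedin (coloring_space G F) ?C"
    unfolding coloring_space_def using T[OF s] s by (intro closedin_no_repetition) auto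
  moreover have "shift_orbit G \<phi> \<subseteq> ?C"
  proof
    fix \<theta> assume "\<theta> \<in> shift_orbit G \<phi>"
    then obtain g where g: "g \<in> carrier G" "\<theta> = shift G g \<phi>" by (auto simp: shift_orbit_def)
    obtain t where "t \<in> T s" "\<phi> (inv g \<otimes> t) \<noteq> \<phi> (inv g \<otimes> (s \<otimes> t))"
      using free[OF inv_closed[OF g(1)] s] by blast
    moreover from this have "t \<in> carrier G" using T[OF s] by auto
    ultimately show "\<theta> \<in> ?C" using g s \<phi> by (auto simp: shift_closed) (auto simp: shift_def)
  qed
  ultimately have "\<psi> \<in> ?C" using \<psi> closure_of_minimal by blast
  then obtain t where t: "t \<in> T s" "\<psi> t \<noteq> \<psi> (s \<otimes> t)" by blast
  then have "t \<in> carrier G" using T[OF s] by auto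
  with fun_cong[OF fixed, of t] t(2) show False by (simp add: shift_def s_def)
qed

theorem (in group) infinite_countable_group_limit_aperiodic:
  assumes "infinite (carrier G)" "countable (carrier G)" "finite F" "card F \<ge> 9"
  shows "\<exists>\<phi>. limit_aperiodic_coloring G F \<phi>"
proof -
  obtain T \<phi> where "\<And>s. s \<in> carrier G - {\<one>} \<Longrightarrow> finite (T s) \<and> T s \<subseteq> carrier G"
    "\<phi> \<in> carrier G \<rightarrow>\<^sub>E F"
    "\<And>g s. \<lbrakk>g \<in> carrier G; s \<in> carrier G - {\<one>}\<rbrakk> \<Longrightarrow> \<exists>t\<in>T s. \<phi> (g \<otimes> t) \<noteq> \<phi> (g \<otimes> (s \<otimes> t))"
    using no_translation_repetitions[OF assms] by metis
  then have "limit_aperiodic_coloring G F \<phi>" by (rule limit_aperiodicI)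
  then show ?thesis by blast
qed

section \<open>Torsion-free hyperbolic groups\<close>

lemma finitely_generated_group_countable:
  fixes G (structure)
  assumes "finitely_generated_group G"
  shows "countable (carrier G)"
proof -
  obtain S where G: "group G" and S: "finite S" "S \<subseteq> carrier G" "generate G S = carrier G"
    using assms by (auto simp: finitely_generated_group_def)
  interpret group G by fact
  let ?L = "lists (S \<union> (\<lambda>s. inv s) ` S)"
  have "carrier G \<subseteq> (\<lambda>ws. foldr (\<otimes>) ws \<one>) ` ?L"
  proof
    fix g assume "g \<in> carrier G"
    from word_exists[OF S(2,3) this] show "g \<in> (\<lambda>ws. foldr (\<otimes>) ws \<one>) ` ?L"
      by (auto simp: lists_eq_set)
  qed
  moreover have "countable ?L" using S(1) by (simp add: countable_finite)
  ultimately show ?thesis by (meson countable_image countable_subset)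
qed

lemma finite_torsion_free_group_trivial:
  fixes G (structure)
  assumes "torsion_free_group G" "finite (carrier G)"
  shows "carrier G = {\<one>}"
proof -
  interpret group G using assms(1) by (simp add: torsion_free_group_def)
  have "g = \<one>" if "g \<in> carrier G" for g
    using assms that pow_order_eq_1[OF that] order_gt_0_iff_finite
    by (auto simp: torsion_free_group_def)
  then show ?thesis by auto
qed

theorem theorem2:
  fixes G :: "('a, 'b) monoid_scheme"
  assumes "group G"
    and "finitely_generated_group G"
    and "torsion_free_group G"
    and "hyperbolic_group G"
  shows "\<exists>(F :: nat set) \<phi>. card F = 9 \<and> limit_aperiodic_coloring G F \<phi>"
proof -
  interpret group G by fact
  have "\<exists>\<phi>. limit_aperiodic_coloring G {..<9::nat} \<phi>"
  proof (cases "finite (carrier G)")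
    case True
    then have "carrier G = {\<one>\<^bsub>G\<^esub>}" by (rule finite_torsion_free_group_trivial[OF assms(3)])
    then have "limit_aperiodic_coloring G {..<9::nat} (\<lambda>_\<in>carrier G. 0)"
      by (auto simp: limit_aperiodic_coloring_def aperiodic_coloring_def)
    then show ?thesis by blast
  next
    case False
    then show ?thesis
      using finitely_generated_group_countable[OF assms(2)]
      by (intro infinite_countable_group_limit_aperiodic) auto
  qed
  then show ?thesis by (intro exI[of _ "{..<9}"]) simp
qed

end
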